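(* Let $\Omega\subseteq\mathbb{R}^n$ be either $\mathbb{R}^n$ or a (bounded or unbounded) domain with smooth boundary containing the origin. Let $\alpha\in\mathbb{R}$, $t\in\mathbb{R}$, $1\le p<\infty$, and assume $Q+\alpha-p>0$. Then for every $\phi\in C_0^\infty(\Omega)$, $$\int_\Omega\rho^{\alpha}|\nabla_\gamma\rho|^t|\nabla_\gamma\phi|^p\,dz\ \ge\ \Big(\frac{Q+\alpha-p}{p}\Big)^p\int_\Omega\rho^{\alpha}|\nabla_\gamma\rho|^t\frac{|\nabla_\gamma\rho|^p}{\rho^p}|\phi|^p\,dz .$$
   Context: Points of $\mathbb{R}^n$ are written $z=(x,y)$ with $x\in\mathbb{R}^m$, $y\in\mathbb{R}^k$, $m,k\ge1$, $n=m+k$, and $\gamma>0$. The Baouendi–Grushin gradient is $\nabla_\gamma=(\partial_{x_1},\dots,\partial_{x_m},|x|^\gamma\partial_{y_1},\dots,|x|^\gamma\partial_{y_k})$. The homogeneous dimension is $Q=m+(1+\gamma)k$. The gauge is $\rho(z)=\big(|x|^{2(1+\gamma)}+(1+\gamma)^2|y|^2\big)^{\frac{1}{2(1+\gamma)}}$; one has $|\nabla_\gamma\rho|=|x|^\gamma/\rho^\gamma$. The integral on the left-hand side is allowed to be $+\infty$. *)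

theory Defs
  imports "HOL-Analysis.Analysis"
begin

fun dderiv :: "'a::real_normed_vector list \<Rightarrow> ('a \<Rightarrow> real) \<Rightarrow> ('a \<Rightarrow> real)" where
  "dderiv [] f = f"
| "dderiv (v # vs) f = (\<lambda>z. frechet_derivative (dderiv vs f) (at z) v)"

definition smooth_on :: "'a::real_normed_vector set \<Rightarrow> ('a \<Rightarrow> real) \<Rightarrow> bool" where
  "smooth_on U f \<longleftrightarrow> (\<forall>vs. \<forall>z\<in>U. dderiv vs f differentiable (at z))"

text \<open>C_0^infinity(Omega): smooth functions on the whole space with compact support inside Omega
  (the standard identification via extension by zero).\<close>
definition test_functions :: "'a::euclidean_space set \<Rightarrow> ('a \<Rightarrow> real) set" where
  "test_functions \<Omega> = {\<phi>. smooth_on UNIV \<phi> \<and> compact (closure {z. \<phi> z \<noteq> 0})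
                              \<and> closure {z. \<phi> z \<noteq> 0} \<subseteq> \<Omega>}"

definition smooth_boundary :: "'a::euclidean_space set \<Rightarrow> bool" where
  "smooth_boundary \<Omega> \<longleftrightarrow> (\<forall>p\<in>frontier \<Omega>. \<exists>U r. open U \<and> p \<in> U \<and> smooth_on U r
      \<and> frechet_derivative r (at p) \<noteq> (\<lambda>v. 0) \<and> \<Omega> \<inter> U = {z\<in>U. r z < 0})"

definition grushin_grad :: "real \<Rightarrow> ('a::euclidean_space \<times> 'b::euclidean_space \<Rightarrow> real)
    \<Rightarrow> 'a \<times> 'b \<Rightarrow> 'a \<times> 'b" where
  "grushin_grad \<gamma> f z =
     ((\<Sum>b\<in>Basis. frechet_derivative f (at z) (b, 0) *\<^sub>R b),
      (norm (fst z) powr \<gamma>) *\<^sub>R (\<Sum>b\<in>Basis. frechet_derivative f (at z) (0, b) *\<^sub>R b))"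

definition hom_dim :: "real \<Rightarrow> 'a::euclidean_space itself \<Rightarrow> 'b::euclidean_space itself \<Rightarrow> real" where
  "hom_dim \<gamma> _ _ = real DIM('a) + (1 + \<gamma>) * real DIM('b)"

definition gauge :: "real \<Rightarrow> 'a::euclidean_space \<times> 'b::euclidean_space \<Rightarrow> real" where
  "gauge \<gamma> z = (norm (fst z) powr (2 * (1 + \<gamma>)) + (1 + \<gamma>)\<^sup>2 * (norm (snd z))\<^sup>2)
                  powr (1 / (2 * (1 + \<gamma>)))"

end

theory Submission
  imports Defs
begin

text \<open>
  Let \<open>\<delta>\<^sub>s(x,y) = (exp(s) x, exp((1 + \<gamma>)s) y)\<close> be the Grushin dilations and \<open>E\<close> their generator.  Along an orbit,
  \<open>\<phi>(z)\<close> is minus the integral of \<open>(E \<phi>)(\<delta>\<^sub>s z)\<close> over \<open>s \<ge> 0\<close>.  With \<open>a = (Q + \<alpha> - p) / p\<close>, Jensen's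
  inequality for the probability density \<open>a exp(-a s)\<close> bounds \<open>|\<phi>(z)|\<^sup>p\<close> by an average of the powers
  \<open>|(E \<phi>)(\<delta>\<^sub>s z)|\<^sup>p\<close>.  Since the weight on the right-hand side of the theorem is homogeneous of
  degree \<open>\<alpha> - p\<close>, Tonelli and a change of variables give the Hardy inequality with \<open>E \<phi>\<close> in place of
  the gradient and with the sharp constant.  Finally \<open>|E \<phi>| |\<nabla>\<^sub>\<gamma> \<rho>| / \<rho> \<le> |\<nabla>\<^sub>\<gamma> \<phi>|\<close> by Cauchy--Schwarz.
  Every step is an inequality between integrals with values in \<open>[0, \<infinity>]\<close>, so local integrability
  of the weights, which can fail for negative \<open>t\<close>, plays no role.
\<close>

section \<open>A one-dimensional Hardy inequality\<close>

text \<open>Convexity on the open half-line covers \<open>x > 0\<close>. At \<open>x = 0\<close> the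
  tangent has the value \<open>(1 - p) * c powr p\<close>, which is at most 0.\<close>

lemma powr_ge_tangent:
  fixes x c p :: real
  assumes "0 \<le> x" "0 < c" "1 \<le> p"
  shows "x powr p \<ge> c powr p + p * c powr (p - 1) * (x - c)"
proof (cases "x = 0")
  case True
  have "c powr p = c powr (p - 1) * c"
    using assms by (simp add: powr_diff)
  then have "c powr p + p * c powr (p - 1) * (x - c) = (1 - p) * c powr p"
    using True by (simp add: algebra_simps)
  also have "\<dots> \<le> 0" using assms by (simp add: mult_nonpos_nonneg)
  finally show ?thesis using True by simp
next
  case False
  have "x powr p - c powr p \<ge> (p * c powr (p - 1)) * (x - c)"
  proof (rule convex_on_imp_above_tangent[where A="{0<..}"])
    show "convex_on {0<..} (\<lambda>x. x powr p)" using powr_convex assms by auto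
    show "connected {0::real<..}" by simp
    show "c \<in> interior {0<..}" using assms by (simp add: interior_open)
    show "x \<in> {0<..}" using assms False by simp
    show "((\<lambda>x. x powr p) has_real_derivative p * c powr (p - 1)) (at c within {0<..})"
      using assms by (auto intro!: derivative_eq_intros simp: powr_diff field_simps)
  qed
  then show ?thesis by simp
qed

text \<open>Jensen's inequality by integrating the tangent line of \<open>x powr p\<close> at \<open>\<bar>f 0\<bar>\<close>; replacing \<open>\<bar>g s\<bar>\<close> by
  \<open>- sgn (f 0) * g s\<close> makes the lower bound \<open>k\<close> an exact derivative.\<close>
lemma hardy_one_dim:
  fixes f g :: "real \<Rightarrow> real"
  assumes deriv: "\<And>s. (f has_real_derivative g s) (at s)"
    and cont: "continuous_on UNIV g"
    and "0 \<le> S" "f S = 0" "0 < a" "1 \<le> p"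
  shows "ennreal (\<bar>f 0\<bar> powr p)
    \<le> (\<integral>\<^sup>+s. ennreal (a * exp (- a * s) * (exp (a * s) * \<bar>g s\<bar> / a) powr p) * indicator {0..} s \<partial>lborel)"
proof (cases "f 0 = 0")
  case False
  define c where "c = \<bar>f 0\<bar>"
  have c: "c > 0" using False by (simp add: c_def)
  define h where "h s = a * exp (- a * s) * (exp (a * s) * \<bar>g s\<bar> / a) powr p" for s
  define k where "k s = a * exp (- a * s) * ((1 - p) * c powr p) - p * c powr (p - 1) * (sgn (f 0) * g s)" for s
  define F where "F s = - exp (- a * s) * ((1 - p) * c powr p) - p * c powr (p - 1) * (sgn (f 0) * f s)" for s
  have cp: "c powr p = c powr (p - 1) * c" using c by (simp add: powr_diff)
  have k_le: "k s \<le> h s" for s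
  proof -
    have "\<bar>g s\<bar> \<ge> - (sgn (f 0) * g s)" using False by (auto simp: sgn_if)
    then have *: "p * c powr (p - 1) * (- (sgn (f 0) * g s)) \<le> p * c powr (p - 1) * \<bar>g s\<bar>"
      using assms by (intro mult_left_mono) auto
    let ?u = "exp (a * s) * \<bar>g s\<bar> / a"
    have "a * exp (- a * s) * (c powr p + p * c powr (p - 1) * (?u - c)) \<le> h s"
      unfolding h_def using assms c by (intro mult_left_mono powr_ge_tangent) auto
    \<comment> \<open>The two exponentials cancel in front of \<open>g\<close>, so its coefficient
      is constant and \<open>k\<close> has the antiderivative \<open>F\<close>.\<close>
    moreover have "a * exp (- a * s) * (c powr p + p * c powr (p - 1) * (?u - c))
        = a * exp (- a * s) * ((1 - p) * c powr p) + p * c powr (p - 1) * \<bar>g s\<bar>"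
      using \<open>0 < a\<close> by (simp add: cp algebra_simps exp_minus)
    ultimately show ?thesis using * by (simp add: k_def)
  qed
  have h0: "h s \<ge> 0" for s using assms by (simp add: h_def)
  have h_cont: "continuous_on UNIV h"
    unfolding h_def using assms by (intro continuous_intros continuous_on_powr' cont) auto
  have k_int: "(k has_integral F S - F 0) {0..S}"
  proof (rule fundamental_theorem_of_calculus)
    show "(F has_vector_derivative k s) (at s within {0..S})" for s
      unfolding has_real_derivative_iff_has_vector_derivative[symmetric] F_def k_def
      by (rule has_field_derivative_at_within)
         (auto intro!: derivative_eq_intros deriv simp: algebra_simps)
  qed fact
  have "sgn (f 0) * f 0 = c" by (simp add: c_def abs_sgn mult.commute)
  \<comment> \<open>\<open>F 0 = - c powr p\<close>. As \<open>f S = 0\<close>, the upper end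
    contributes only the tail of the density beyond \<open>S\<close>, with a nonnegative factor
    since \<open>p \<ge> 1\<close>.\<close>
  then have "F S - F 0 = c powr p + (p - 1) * c powr p * exp (- a * S)"
    using \<open>f S = 0\<close> by (simp add: F_def cp algebra_simps)
  then have "c powr p \<le> F S - F 0" using assms by simp
  also have h_int: "h integrable_on {0..S}"
    using h_cont by (intro integrable_continuous_interval) (rule continuous_on_subset, auto)
  have "F S - F 0 \<le> integral {0..S} h"
    using k_int h_int k_le by (intro has_integral_le[OF k_int integrable_integral]) auto
  finally have "ennreal (c powr p) \<le> ennreal (integral {0..S} h)" by (rule ennreal_leI)
  also have "\<dots> = (\<integral>\<^sup>+s. ennreal (h s) * indicator {0..S} s \<partial>lborel)"
  proof -
    have "(\<integral>\<^sup>+s. ennreal (h s) * indicator {0..S} s \<partial>lborel)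
        = (\<integral>\<^sup>+s. ennreal (h s * indicator {0..S} s) \<partial>lborel)"
      by (intro nn_integral_cong) (auto split: split_indicator)
    also have "\<dots> = ennreal (integral {0..S} h)"
    proof (rule nn_integral_has_integral_lborel)
      have "h \<in> borel_measurable borel" using h_cont by (rule borel_measurable_continuous_onI)
      then show "(\<lambda>s. h s * indicator {0..S} s) \<in> borel_measurable borel" by simp
      show "((\<lambda>s. h s * indicator {0..S} s) has_integral integral {0..S} h) UNIV"
      proof -
        have "(\<lambda>s. h s * indicator {0..S} s) = (\<lambda>s. if s \<in> {0..S} then h s else 0)"
          by (auto simp: indicator_def)
        then show ?thesis
          using integrable_integral[OF h_int] by (simp only: has_integral_restrict_UNIV)
      qed
    qed (use h0 in auto)
    finally show ?thesis ..
  qed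
  also have "\<dots> \<le> (\<integral>\<^sup>+s. ennreal (h s) * indicator {0..} s \<partial>lborel)"
    by (intro nn_integral_mono) (auto split: split_indicator)
  finally show ?thesis by (simp add: c_def h_def)
qed (use assms in auto)

text \<open>Normalisation of the Jensen weight: since its mass is 1, integrating out
  \<open>s\<close> in \<open>hardy_dilation\<close> costs no constant.\<close>

lemma nn_integral_exp_decay:
  fixes a :: real
  assumes "0 < a"
  shows "(\<integral>\<^sup>+s. ennreal (a * exp (- a * s)) * indicator {0..} s \<partial>lborel) = 1"
proof -
  have "((\<lambda>s. - exp (- a * s)) \<longlongrightarrow> - 0) at_top"
  proof (rule tendsto_minus, rule filterlim_compose[OF exp_at_bot])
    show "filterlim (\<lambda>s. - a * s) at_bot at_top"
      using assms filterlim_tendsto_neg_mult_at_bot[OF tendsto_const, of "-a" "\<lambda>s. s" at_top]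
      by (simp add: filterlim_ident)
  qed
  then have "(\<integral>\<^sup>+s. ennreal (a * exp (- a * s)) * indicator {0..} s \<partial>lborel) = ennreal (- 0 - (- exp (- a * 0)))"
    using assms by (intro nn_integral_FTC_atLeast) (auto intro!: derivative_eq_intros)
  then show ?thesis by simp
qed

section \<open>Dilations\<close>

lemma nn_integral_lborel_scaleR:
  fixes f :: "'a::euclidean_space \<Rightarrow> ennreal"
  assumes [measurable]: "f \<in> borel_measurable borel" and "c > 0"
  shows "(\<integral>\<^sup>+x. f x \<partial>lborel) = ennreal (c ^ DIM('a)) * (\<integral>\<^sup>+x. f (c *\<^sub>R x) \<partial>lborel)"
  by (subst lborel_affine[of c 0])
     (use \<open>c > 0\<close> in \<open>simp_all add: nn_integral_density nn_integral_distr nn_integral_cmult\<close>)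

text \<open>Tonelli separates the two factors, and each is rescaled on its own, first
  \<open>y\<close> and then \<open>x\<close>.\<close>

lemma nn_integral_lborel_scaleR_prod:
  fixes f :: "'a::euclidean_space \<times> 'b::euclidean_space \<Rightarrow> ennreal"
  assumes f[measurable]: "f \<in> borel_measurable borel" and "c > 0" "d > 0"
  shows "(\<integral>\<^sup>+z. f z \<partial>lborel)
    = ennreal (c ^ DIM('a) * d ^ DIM('b)) * (\<integral>\<^sup>+z. f (c *\<^sub>R fst z, d *\<^sub>R snd z) \<partial>lborel)"
proof -
  have [measurable]: "f \<in> borel_measurable (borel \<Otimes>\<^sub>M borel)" by (simp add: borel_prod)
  have "(\<integral>\<^sup>+z. f z \<partial>lborel) = (\<integral>\<^sup>+z. f z \<partial>(lborel \<Otimes>\<^sub>M lborel))"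
    by (simp add: lborel_prod)
  also have "\<dots> = (\<integral>\<^sup>+x. \<integral>\<^sup>+y. f (x, y) \<partial>lborel \<partial>lborel)"
    by (subst lborel.nn_integral_fst[symmetric]) auto
  also have "\<dots> = (\<integral>\<^sup>+x. ennreal (d ^ DIM('b)) * (\<integral>\<^sup>+y. f (x, d *\<^sub>R y) \<partial>lborel) \<partial>lborel)"
    by (subst nn_integral_lborel_scaleR[OF _ \<open>d > 0\<close>]) auto
  also have "\<dots> = ennreal (d ^ DIM('b)) * (\<integral>\<^sup>+x. (\<integral>\<^sup>+y. f (x, d *\<^sub>R y) \<partial>lborel) \<partial>lborel)"
    by (subst nn_integral_cmult) auto
  also have "(\<integral>\<^sup>+x. (\<integral>\<^sup>+y. f (x, d *\<^sub>R y) \<partial>lborel) \<partial>lborel)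
      = ennreal (c ^ DIM('a)) * (\<integral>\<^sup>+x. (\<integral>\<^sup>+y. f (c *\<^sub>R x, d *\<^sub>R y) \<partial>lborel) \<partial>lborel)"
    by (subst nn_integral_lborel_scaleR[OF _ \<open>c > 0\<close>]) auto
  also have "(\<integral>\<^sup>+x. (\<integral>\<^sup>+y. f (c *\<^sub>R x, d *\<^sub>R y) \<partial>lborel) \<partial>lborel)
      = (\<integral>\<^sup>+z. f (c *\<^sub>R fst z, d *\<^sub>R snd z) \<partial>(lborel \<Otimes>\<^sub>M lborel))"
    by (subst lborel.nn_integral_fst[symmetric]) auto
  finally show ?thesis
    using assms(2,3) by (simp add: lborel_prod ennreal_mult ac_simps)
qed

text \<open>The exceptional set lies in a hyperplane. Off it the gauge is positive and
  differentiable and every dilation orbit is unbounded, so the pointwise estimates are made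
  there.\<close>

lemma AE_lborel_fst_neq_0:
  "AE z in lborel. fst (z :: 'a::euclidean_space \<times> 'b::euclidean_space) \<noteq> 0"
proof -
  obtain b :: 'a where b: "b \<in> Basis" using nonempty_Basis by blast
  have "negligible {z :: 'a \<times> 'b. (b, 0) \<bullet> z = 0}"
    using b by (intro negligible_hyperplane) (auto simp: prod_eq_iff)
  then have "negligible {z :: 'a \<times> 'b. fst z = 0}"
    by (rule negligible_subset) (auto simp: inner_prod_def)
  moreover have "{z :: 'a \<times> 'b. fst z = 0} \<in> sets borel"
    by (intro borel_closed closed_Collect_eq continuous_intros)
  ultimately have "{z :: 'a \<times> 'b. fst z = 0} \<in> null_sets lborel"
    by (metis negligible_iff_null_sets null_sets_completion_iff sets_lborel)
  then show ?thesis by (rule AE_I') auto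
qed

section \<open>Grushin dilations and homogeneity\<close>

definition dil :: "real \<Rightarrow> real \<Rightarrow> 'a::euclidean_space \<times> 'b::euclidean_space \<Rightarrow> 'a \<times> 'b" where
  "dil \<gamma> s z = (exp s *\<^sub>R fst z, exp ((1 + \<gamma>) * s) *\<^sub>R snd z)"

text \<open>The velocity of the dilation orbits: differentiation in this direction is the operator
  \<open>E\<close> of the overview.\<close>

definition euler_field :: "real \<Rightarrow> 'a::euclidean_space \<times> 'b::euclidean_space \<Rightarrow> 'a \<times> 'b" where
  "euler_field \<gamma> z = (fst z, (1 + \<gamma>) *\<^sub>R snd z)"

lemma dil_0 [simp]: "dil \<gamma> 0 z = z"
  by (simp add: dil_def)

lemma fst_dil [simp]: "fst (dil \<gamma> s z) = exp s *\<^sub>R fst z"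
  by (simp add: dil_def)

lemma continuous_on_dil [continuous_intros]:
  assumes "continuous_on A f" "continuous_on A g"
  shows "continuous_on A (\<lambda>x. dil \<gamma> (f x) (g x))"
  unfolding dil_def by (intro continuous_intros assms)

lemma dil_has_derivative:
  "((\<lambda>s. dil \<gamma> s z) has_derivative (\<lambda>h. h *\<^sub>R euler_field \<gamma> (dil \<gamma> s z))) (at s)"
  unfolding dil_def euler_field_def
  by (auto intro!: derivative_eq_intros simp: fun_eq_iff)

text \<open>The Jacobian of \<open>dil\<close> is
  \<open>exp s ^ m * exp ((1 + \<gamma>) * s) ^ k = exp (Q * s)\<close>, with \<open>m\<close> and
  \<open>k\<close> the dimensions of the two factors; this is where the homogeneous dimension
  enters.\<close>

lemma nn_integral_dil:
  fixes f :: "'a::euclidean_space \<times> 'b::euclidean_space \<Rightarrow> ennreal"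
  assumes "f \<in> borel_measurable borel"
  shows "(\<integral>\<^sup>+z. f (dil \<gamma> s z) \<partial>lborel)
    = ennreal (exp (- hom_dim \<gamma> TYPE('a) TYPE('b) * s)) * (\<integral>\<^sup>+z. f z \<partial>lborel)"
proof -
  let ?Q = "hom_dim \<gamma> TYPE('a) TYPE('b)"
  have "exp s ^ DIM('a) * exp ((1 + \<gamma>) * s) ^ DIM('b) = exp (?Q * s)"
    by (simp add: hom_dim_def exp_of_nat_mult[symmetric] exp_add[symmetric] algebra_simps)
  then have "(\<integral>\<^sup>+z. f z \<partial>lborel) = ennreal (exp (?Q * s)) * (\<integral>\<^sup>+z. f (dil \<gamma> s z) \<partial>lborel)"
    using nn_integral_lborel_scaleR_prod[OF assms, of "exp s" "exp ((1 + \<gamma>) * s)"]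
    by (simp add: dil_def)
  then show ?thesis
    by (simp add: mult.assoc[symmetric] ennreal_mult[symmetric] exp_add[symmetric])
qed

text \<open>The first component alone outgrows any bound \<open>B\<close>:
  \<open>exp S \<ge> 1 + S\<close>, and \<open>S\<close> is chosen with
  \<open>S * norm (fst z) = B + 1\<close>.\<close>

lemma dil_escapes_bounded:
  fixes z :: "'a::euclidean_space \<times> 'b::euclidean_space"
  assumes "bounded K" "fst z \<noteq> 0"
  obtains S where "0 \<le> S" "dil \<gamma> S z \<notin> K"
proof -
  obtain B where B: "\<And>w. w \<in> K \<Longrightarrow> norm w \<le> B" and "B > 0"
    using \<open>bounded K\<close> by (auto simp: bounded_pos)
  define S where "S = (B + 1) / norm (fst z)"
  have "S \<ge> 0" using \<open>B > 0\<close> by (simp add: S_def)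
  have "B < S * norm (fst z)" using assms by (simp add: S_def)
  also have "\<dots> \<le> exp S * norm (fst z)"
    using exp_ge_add_one_self[of S] by (intro mult_right_mono norm_ge_zero) linarith
  also have "\<dots> = norm (fst (dil \<gamma> S z))" by (simp add: dil_def)
  also have "\<dots> \<le> norm (dil \<gamma> S z)" by (metis norm_fst_le prod.collapse)
  finally have "dil \<gamma> S z \<notin> K" using B[of "dil \<gamma> S z"] by linarith
  with \<open>S \<ge> 0\<close> show thesis by (rule that)
qed

text \<open>Both summands inside the gauge have degree \<open>2 * (1 + \<gamma>)\<close>, and the
  outer root reduces this to degree 1.\<close>

lemma gauge_dil:
  assumes "\<gamma> > 0"
  shows "gauge \<gamma> (dil \<gamma> s z) = exp s * gauge \<gamma> z"
proof -
  let ?X = "norm (fst z)" and ?Y = "norm (snd z)"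
  have "(exp s * ?X) powr (2 * (1 + \<gamma>)) + (1 + \<gamma>)\<^sup>2 * (exp ((1 + \<gamma>) * s) * ?Y)\<^sup>2
      = exp (2 * (1 + \<gamma>) * s) * (?X powr (2 * (1 + \<gamma>)) + (1 + \<gamma>)\<^sup>2 * ?Y\<^sup>2)"
    by (simp add: powr_mult exp_powr_real power_mult_distrib exp_double[symmetric] algebra_simps)
  then show ?thesis
    using assms by (simp add: gauge_def dil_def powr_mult exp_powr_real)
qed

section \<open>Hardy inequality along dilation orbits\<close>

text \<open>Averaging \<open>hardy_one_dim\<close> over all orbits: homogeneity of \<open>V\<close>
  makes each slice at fixed \<open>s\<close> a multiple of one and the same integral. The theorem
  uses \<open>\<beta> = \<alpha> - p\<close>.\<close>

lemma hardy_dilation: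
  fixes \<phi> :: "'a::euclidean_space \<times> 'b::euclidean_space \<Rightarrow> real"
    and V :: "'a \<times> 'b \<Rightarrow> real"
  assumes diff: "\<And>z. \<phi> differentiable (at z)"
    and E_cont: "continuous_on UNIV (\<lambda>z. frechet_derivative \<phi> (at z) (euler_field \<gamma> z))"
    and supp: "bounded {z. \<phi> z \<noteq> 0}"
    and V_meas [measurable]: "V \<in> borel_measurable borel"
    and V_nonneg: "\<And>z. V z \<ge> 0"
    and V_hom: "\<And>s z. V (dil \<gamma> s z) = exp (\<beta> * s) * V z"
    and p: "1 \<le> p" and pos: "hom_dim \<gamma> TYPE('a) TYPE('b) + \<beta> > 0"
  shows "ennreal (((hom_dim \<gamma> TYPE('a) TYPE('b) + \<beta>) / p) powr p)
      * (\<integral>\<^sup>+z. ennreal (V z * \<bar>\<phi> z\<bar> powr p) \<partial>lborel)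
    \<le> (\<integral>\<^sup>+z. ennreal (V z * \<bar>frechet_derivative \<phi> (at z) (euler_field \<gamma> z)\<bar> powr p) \<partial>lborel)"
proof -
  let ?Q = "hom_dim \<gamma> TYPE('a) TYPE('b)"
  define E where "E z = frechet_derivative \<phi> (at z) (euler_field \<gamma> z)" for z
  \<comment> \<open>Chosen so that \<open>a * p - \<beta>\<close> is the homogeneous dimension,
    which makes the exponentials in \<open>slice\<close> cancel.\<close>
  define a where "a = (?Q + \<beta>) / p"
  have a: "a > 0" using p pos by (simp add: a_def)
  have E_cont: "continuous_on UNIV E" using E_cont by (simp add: E_def[abs_def])
  have [measurable]: "E \<in> borel_measurable borel"
    using E_cont by (rule borel_measurable_continuous_onI)
  have "continuous_on UNIV \<phi>"
    using diff by (simp add: continuous_at_imp_continuous_on differentiable_imp_continuous_within)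
  then have [measurable]: "\<phi> \<in> borel_measurable borel" by (rule borel_measurable_continuous_onI)
  \<comment> \<open>Joint measurability in \<open>s\<close> and \<open>z\<close>, for the exchange
    of integrals below.\<close>
  have dil_meas: "(\<lambda>x. dil \<gamma> (fst x) (snd x)) \<in> borel \<Otimes>\<^sub>M borel \<rightarrow>\<^sub>M borel"
    unfolding borel_prod by (intro borel_measurable_continuous_onI continuous_intros)
  note [measurable] = measurable_compose[OF measurable_Pair dil_meas, simplified]
  define I where "I = (\<integral>\<^sup>+z. ennreal (V z * \<bar>E z\<bar> powr p) \<partial>lborel)"
  \<comment> \<open>The integrand of \<open>hardy_one_dim\<close> along the orbit of
    \<open>z\<close>, multiplied by \<open>a powr p\<close> to remove the divisor
    \<open>a\<close>.\<close>
  define W where "W s z = ennreal (a * exp (- a * s) * (exp (a * s) * \<bar>E (dil \<gamma> s z)\<bar>) powr p) * indicator {0..} s" for s z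

  have one_dim: "ennreal (a powr p) * ennreal (\<bar>\<phi> z\<bar> powr p) \<le> (\<integral>\<^sup>+s. W s z \<partial>lborel)"
    if z: "fst z \<noteq> 0" for z
  proof -
    \<comment> \<open>The orbit leaves the bounded support, which supplies the zero that
      \<open>hardy_one_dim\<close> asks for.\<close>
    obtain S where S: "0 \<le> S" "\<phi> (dil \<gamma> S z) = 0"
      using dil_escapes_bounded[OF supp z, of \<gamma>] by auto
    have "((\<lambda>s. \<phi> (dil \<gamma> s z)) has_real_derivative E (dil \<gamma> s z)) (at s)" for s
    proof -
      have D: "(\<phi> has_derivative frechet_derivative \<phi> (at (dil \<gamma> s z))) (at (dil \<gamma> s z))"
        using diff frechet_derivative_works by blast
      then interpret bounded_linear "frechet_derivative \<phi> (at (dil \<gamma> s z))"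
        by (rule has_derivative_bounded_linear)
      show ?thesis
        using has_derivative_compose[OF dil_has_derivative D]
        by (simp add: has_field_derivative_def E_def scale mult.commute[of _ "frechet_derivative _ _ _"])
    qed
    moreover have "continuous_on UNIV (\<lambda>s. E (dil \<gamma> s z))"
      by (intro continuous_on_compose2[OF E_cont] continuous_intros) auto
    ultimately have "ennreal (\<bar>\<phi> (dil \<gamma> 0 z)\<bar> powr p)
        \<le> (\<integral>\<^sup>+s. ennreal (a * exp (- a * s) * (exp (a * s) * \<bar>E (dil \<gamma> s z)\<bar> / a) powr p) * indicator {0..} s \<partial>lborel)"
      using S a p by (intro hardy_one_dim) auto
    then have "ennreal (a powr p) * ennreal (\<bar>\<phi> z\<bar> powr p)
        \<le> ennreal (a powr p) * (\<integral>\<^sup>+s. ennreal (a * exp (- a * s) * (exp (a * s) * \<bar>E (dil \<gamma> s z)\<bar> / a) powr p) * indicator {0..} s \<partial>lborel)"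
      by (intro mult_left_mono) auto
    also have "\<dots> = (\<integral>\<^sup>+s. W s z \<partial>lborel)"
      using a by (subst nn_integral_cmult[symmetric])
        (auto intro!: nn_integral_cong simp: W_def powr_divide ennreal_mult[symmetric] split: split_indicator)
    finally show ?thesis .
  qed

  \<comment> \<open>Here \<open>V z = exp (- \<beta> * s) * V (dil \<gamma> s z)\<close>, the power
    contributes \<open>exp (a * p * s)\<close> and the change of variables
    \<open>exp (- ?Q * s)\<close>; only the probability density remains.\<close>
  have slice: "(\<integral>\<^sup>+z. ennreal (V z) * W s z \<partial>lborel) = ennreal (a * exp (- a * s)) * indicator {0..} s * I" for s
  proof -
    have "ennreal (V z) * W s z
        = ennreal (a * exp (- a * s)) * indicator {0..} s * ennreal (exp ((a * p - \<beta>) * s))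
            * ennreal (V (dil \<gamma> s z) * \<bar>E (dil \<gamma> s z)\<bar> powr p)" for z
      using a V_nonneg[of z]
      by (auto simp: W_def V_hom powr_mult exp_powr_real ennreal_mult[symmetric] left_diff_distrib exp_diff
            algebra_simps split: split_indicator)
    then have "(\<integral>\<^sup>+z. ennreal (V z) * W s z \<partial>lborel)
      = ennreal (a * exp (- a * s)) * indicator {0..} s * ennreal (exp ((a * p - \<beta>) * s))
          * (\<integral>\<^sup>+z. ennreal (V (dil \<gamma> s z) * \<bar>E (dil \<gamma> s z)\<bar> powr p) \<partial>lborel)"
      by (simp add: nn_integral_cmult)
    also have "(\<integral>\<^sup>+z. ennreal (V (dil \<gamma> s z) * \<bar>E (dil \<gamma> s z)\<bar> powr p) \<partial>lborel)
        = ennreal (exp (- ?Q * s)) * I"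
      unfolding I_def by (rule nn_integral_dil) measurable
    also have "a * p - \<beta> = ?Q" using p by (simp add: a_def)
    finally show ?thesis
      by (simp add: mult.assoc ennreal_mult[symmetric] exp_add[symmetric] flip: mult.assoc[of "ennreal (exp (?Q * s))"])
  qed

  have "ennreal (a powr p) * (\<integral>\<^sup>+z. ennreal (V z * \<bar>\<phi> z\<bar> powr p) \<partial>lborel)
      = (\<integral>\<^sup>+z. ennreal (V z) * (ennreal (a powr p) * ennreal (\<bar>\<phi> z\<bar> powr p)) \<partial>lborel)"
    by (subst nn_integral_cmult[symmetric])
       (auto intro!: nn_integral_cong simp: ennreal_mult V_nonneg ac_simps)
  also have "\<dots> \<le> (\<integral>\<^sup>+z. ennreal (V z) * (\<integral>\<^sup>+s. W s z \<partial>lborel) \<partial>lborel)"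
    using AE_lborel_fst_neq_0
    by (intro nn_integral_mono_AE, eventually_elim) (intro mult_left_mono one_dim, auto)
  also have "\<dots> = (\<integral>\<^sup>+z. (\<integral>\<^sup>+s. ennreal (V z) * W s z \<partial>lborel) \<partial>lborel)"
    unfolding W_def by (subst nn_integral_cmult) auto
  also have "\<dots> = (\<integral>\<^sup>+s. (\<integral>\<^sup>+z. ennreal (V z) * W s z \<partial>lborel) \<partial>lborel)"
    unfolding W_def by (rule lborel_pair.Fubini') measurable
  also have "\<dots> = (\<integral>\<^sup>+s. ennreal (a * exp (- a * s)) * indicator {0..} s \<partial>lborel) * I"
    unfolding slice by (rule nn_integral_multc) measurable
  also have "\<dots> = I" by (simp only: nn_integral_exp_decay[OF a] mult_1)
  finally show ?thesis by (simp add: a_def I_def E_def)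
qed

section \<open>The Grushin gradient\<close>

lemma powr_double: "(x::real) powr (2 * r) = (x powr r)\<^sup>2"
  unfolding mult_2 powr_add by (rule power2_eq_square[symmetric])

lemma gauge_pos:
  assumes "fst z \<noteq> 0"
  shows "gauge \<gamma> z > 0"
proof -
  have "norm (fst z) powr (2 * (1 + \<gamma>)) + (1 + \<gamma>)\<^sup>2 * (norm (snd z))\<^sup>2 > 0"
    using assms by (intro add_pos_nonneg) auto
  then show ?thesis by (simp add: gauge_def)
qed

lemma gauge_powr:
  assumes "\<gamma> > 0"
  shows "gauge \<gamma> z powr (2 * (1 + \<gamma>))
    = norm (fst z) powr (2 * (1 + \<gamma>)) + (1 + \<gamma>)\<^sup>2 * (norm (snd z))\<^sup>2"
  using assms by (simp add: gauge_def powr_powr)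

text \<open>Evaluating the derivative on basis vectors gives the coordinates of \<open>u\<close> and
  \<open>v\<close>, the Euclidean gradients in the two variables.\<close>

lemma grushin_grad_inner:
  assumes "\<And>h. frechet_derivative f (at z) h = u \<bullet> fst h + v \<bullet> snd h"
  shows "grushin_grad \<gamma> f z = (u, (norm (fst z) powr \<gamma>) *\<^sub>R v)"
  by (simp add: grushin_grad_def assms euclidean_representation)

text \<open>The weight in the second component makes the expression \<open>P\<close> inside the
  gauge reappear: the squared norm is \<open>(M * X powr \<gamma>)\<^sup>2 * P\<close>.\<close>

lemma norm_grushin_grad_gauge:
  fixes z :: "'a::euclidean_space \<times> 'b::euclidean_space"
  assumes \<gamma>: "\<gamma> > 0" and z: "fst z \<noteq> 0"
  shows "norm (grushin_grad \<gamma> (gauge \<gamma>) z) = norm (fst z) powr \<gamma> / gauge \<gamma> z powr \<gamma>"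
proof -
  define X where "X = norm (fst z)"
  define P where "P = X powr (2 * (1 + \<gamma>)) + (1 + \<gamma>)\<^sup>2 * (norm (snd z))\<^sup>2"
  \<comment> \<open>Up to the factor \<open>1 / (2 * (1 + \<gamma>))\<close>, the derivative of the
    outer power at \<open>P\<close>.\<close>
  define M where "M = P powr (1 / (2 * (1 + \<gamma>)) - 1)"
  have X: "X > 0" using z by (simp add: X_def)
  have P: "P > 0" unfolding P_def using X by (intro add_pos_nonneg) auto
  have sq: "(x \<bullet> x) powr r = norm x powr (2 * r)" for x :: 'a and r
    unfolding power2_norm_eq_inner[symmetric] powr_double power2_eq_square
    by (simp add: powr_mult)
  \<comment> \<open>Inner products replace the norms, so that the derivative rules for
    \<open>powr\<close> and for bilinear maps apply.\<close>
  have gauge_eq: "gauge \<gamma> = (\<lambda>w :: 'a \<times> 'b. ((fst w \<bullet> fst w) powr (1 + \<gamma>)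
      + (1 + \<gamma>)\<^sup>2 * (snd w \<bullet> snd w)) powr (1 / (2 * (1 + \<gamma>))))"
    by (simp add: fun_eq_iff gauge_def sq power2_norm_eq_inner)
  have pz: "fst z \<bullet> fst z > 0" using z by simp
  have Pz: "(fst z \<bullet> fst z) powr (1 + \<gamma>) + (1 + \<gamma>)\<^sup>2 * (snd z \<bullet> snd z) = P"
    by (simp add: P_def X_def sq power2_norm_eq_inner)
  have Xz: "(fst z \<bullet> fst z) powr (1 + \<gamma>) = X powr (2 * \<gamma>) * (fst z \<bullet> fst z)"
    using pz by (simp add: powr_add sq X_def)
  let ?u = "(M * X powr (2 * \<gamma>)) *\<^sub>R fst z" and ?v = "(M * (1 + \<gamma>)) *\<^sub>R snd z"
  have inner_deriv: "((\<lambda>w. (fst w \<bullet> fst w) powr (1 + \<gamma>)) has_derivative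
      (\<lambda>h. (1 + \<gamma>) * X powr (2 * \<gamma>) * (2 * (fst z \<bullet> fst h)))) (at z)"
  proof -
    have "((\<lambda>w. (fst w \<bullet> fst w) powr (1 + \<gamma>)) has_derivative
      (\<lambda>h. (fst z \<bullet> fst z) powr (1 + \<gamma>) * (0 * ln (fst z \<bullet> fst z)
         + (fst z \<bullet> fst h + fst h \<bullet> fst z) * (1 + \<gamma>) / (fst z \<bullet> fst z)))) (at z)"
      using pz by (intro has_derivative_powr) (auto intro!: derivative_eq_intros)
    then show ?thesis
      by (rule has_derivative_eq_rhs)
         (use z in \<open>simp add: fun_eq_iff Xz inner_commute field_simps\<close>)
  qed
  have "(gauge \<gamma> has_derivative (\<lambda>h. ?u \<bullet> fst h + ?v \<bullet> snd h)) (at z)"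
  proof -
    have "(gauge \<gamma> has_derivative (\<lambda>h. P powr (1 / (2 * (1 + \<gamma>))) * (0 * ln P
        + ((1 + \<gamma>) * X powr (2 * \<gamma>) * (2 * (fst z \<bullet> fst h))
           + (1 + \<gamma>)\<^sup>2 * (snd z \<bullet> snd h + snd h \<bullet> snd z)) * (1 / (2 * (1 + \<gamma>))) / P))) (at z)"
      unfolding gauge_eq Pz[symmetric] using P Pz
      by (intro has_derivative_powr has_derivative_add inner_deriv) (auto intro!: derivative_eq_intros)
    moreover have "P powr (1 / (2 * (1 + \<gamma>))) * (0 * ln P
        + ((1 + \<gamma>) * X powr (2 * \<gamma>) * (2 * (fst z \<bullet> fst h))
           + (1 + \<gamma>)\<^sup>2 * (snd z \<bullet> snd h + snd h \<bullet> snd z)) * (1 / (2 * (1 + \<gamma>))) / P)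
        = ?u \<bullet> fst h + ?v \<bullet> snd h" for h
    proof -
      have *: "m * P * (0 * l + (K * r * (2 * x) + K\<^sup>2 * (y + y)) * (1 / (2 * K)) / P) = m * r * x + m * K * y"
        if "K > 0" for m l r x y K :: real
        using P that by (simp add: field_simps power2_eq_square)
      have "P powr (1 / (2 * (1 + \<gamma>))) = M * P" using P by (simp add: M_def powr_diff)
      then show ?thesis
        using *[of "1 + \<gamma>"] \<gamma> by (simp only: inner_commute[of "snd h"]) simp
    qed
    ultimately show ?thesis by (simp only:)
  qed
  then have "frechet_derivative (gauge \<gamma>) (at z) h = ?u \<bullet> fst h + ?v \<bullet> snd h" for h
    by (simp add: frechet_derivative_at[symmetric])
  then have G: "grushin_grad \<gamma> (gauge \<gamma>) z = (?u, X powr \<gamma> *\<^sub>R ?v)"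
    unfolding X_def by (rule grushin_grad_inner)
  have M0: "M > 0" using P by (simp add: M_def)
  have X1: "X powr (2 * (1 + \<gamma>)) = (X powr \<gamma>)\<^sup>2 * X\<^sup>2"
    using X unfolding powr_double by (simp add: powr_add power_mult_distrib)
  have "(norm (grushin_grad \<gamma> (gauge \<gamma>) z))\<^sup>2
      = (M * X powr (2 * \<gamma>) * X)\<^sup>2 + (X powr \<gamma> * (M * (1 + \<gamma>) * norm (snd z)))\<^sup>2"
    using M0 \<gamma> by (simp add: G norm_Pair X_def abs_mult)
  also have "\<dots> = M\<^sup>2 * (X powr \<gamma>)\<^sup>2 * P"
    unfolding P_def X1 powr_double[of X \<gamma>] by (simp add: power_mult_distrib algebra_simps power2_eq_square)
  also have "P = (P powr (1/2))\<^sup>2" using P by (simp add: powr_half_sqrt)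
  finally have "(norm (grushin_grad \<gamma> (gauge \<gamma>) z))\<^sup>2 = (M * X powr \<gamma> * P powr (1/2))\<^sup>2"
    by (simp add: power_mult_distrib)
  then have "norm (grushin_grad \<gamma> (gauge \<gamma>) z) = X powr \<gamma> * (M * P powr (1/2))"
    using M0 by (subst (asm) power2_eq_iff_nonneg) auto
  \<comment> \<open>The exponents add up: \<open>1 / (2 * (1 + \<gamma>)) - 1 + 1 / 2 = - (\<gamma>
    / (2 * (1 + \<gamma>)))\<close>.\<close>
  also have "M * P powr (1/2) = P powr (- (\<gamma> / (2 * (1 + \<gamma>))))"
    using \<gamma> unfolding M_def by (subst powr_add[symmetric]) (simp add: field_simps)
  also have "\<dots> = 1 / gauge \<gamma> z powr \<gamma>"
    using P by (simp add: gauge_def powr_powr powr_minus_divide P_def X_def)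
  finally show ?thesis by (simp add: X_def)
qed

text \<open>Cauchy--Schwarz in the Grushin frame: there the Euler field is the vector \<open>w\<close> of the proof,
  of length \<open>\<rho> / |\<nabla>\<^sub>\<gamma> \<rho>|\<close>.\<close>
lemma euler_derivative_le_grushin_grad:
  fixes z :: "'a::euclidean_space \<times> 'b::euclidean_space"
  assumes \<gamma>: "\<gamma> > 0" and z: "fst z \<noteq> 0" and diff: "\<phi> differentiable (at z)"
  shows "norm (fst z) powr \<gamma> / gauge \<gamma> z powr \<gamma> / gauge \<gamma> z
      * \<bar>frechet_derivative \<phi> (at z) (euler_field \<gamma> z)\<bar> \<le> norm (grushin_grad \<gamma> \<phi> z)"
proof -
  define L where "L = frechet_derivative \<phi> (at z)"
  have "bounded_linear L"
    unfolding L_def using diff frechet_derivative_works has_derivative_bounded_linear by blast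
  then interpret L: bounded_linear L .
  define u where "u = (\<Sum>b\<in>Basis. L (b, 0) *\<^sub>R b)"
  define v where "v = (\<Sum>b\<in>Basis. L (0, b) *\<^sub>R b)"
  define r where "r = norm (fst z) powr \<gamma>"
  have r: "r > 0" using z by (simp add: r_def)
  have L_eq: "L h = u \<bullet> fst h + v \<bullet> snd h" for h
  proof -
    have "h = (\<Sum>b\<in>Basis. (fst h \<bullet> b) *\<^sub>R (b, 0)) + (\<Sum>b\<in>Basis. (snd h \<bullet> b) *\<^sub>R (0, b))"
      by (simp add: prod_eq_iff fst_sum snd_sum euclidean_representation)
    then have "L h = L (\<Sum>b\<in>Basis. (fst h \<bullet> b) *\<^sub>R (b, 0)) + L (\<Sum>b\<in>Basis. (snd h \<bullet> b) *\<^sub>R (0, b))"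
      by (metis L.add)
    then show ?thesis
      unfolding L.sum L.scale u_def v_def inner_sum_left
      by (simp add: inner_commute mult.commute)
  qed
  \<comment> \<open>Dividing by \<open>r\<close> compensates the factor \<open>r\<close> in the
    second component of the Grushin gradient.\<close>
  define w :: "'a \<times> 'b" where "w = (fst z, ((1 + \<gamma>) / r) *\<^sub>R snd z)"
  have G: "grushin_grad \<gamma> \<phi> z = (u, r *\<^sub>R v)"
    unfolding r_def by (rule grushin_grad_inner) (simp add: L_def[symmetric] L_eq)
  have "L (euler_field \<gamma> z) = grushin_grad \<gamma> \<phi> z \<bullet> w"
    using r by (simp add: L_eq G w_def euler_field_def)
  then have CS: "\<bar>L (euler_field \<gamma> z)\<bar> \<le> norm (grushin_grad \<gamma> \<phi> z) * norm w"
    by (simp add: Cauchy_Schwarz_ineq2)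
  have \<rho>: "gauge \<gamma> z > 0" using z by (rule gauge_pos)
  have "(gauge \<gamma> z powr (1 + \<gamma>))\<^sup>2 = gauge \<gamma> z powr (2 * (1 + \<gamma>))"
    by (rule powr_double[symmetric])
  also have "\<dots> = (r * norm w)\<^sup>2"
  proof -
    have "norm (fst z) powr (2 * (1 + \<gamma>)) = r\<^sup>2 * (norm (fst z))\<^sup>2"
      using z unfolding powr_double by (simp add: r_def powr_add power_mult_distrib)
    then show ?thesis
      using r \<gamma> unfolding gauge_powr[OF \<gamma>]
      by (simp add: w_def norm_Pair power_mult_distrib power_divide distrib_left)
  qed
  finally have "gauge \<gamma> z powr (1 + \<gamma>) = r * norm w"
    using r by (subst (asm) power2_eq_iff_nonneg) auto
  then have "r * norm w = gauge \<gamma> z powr \<gamma> * gauge \<gamma> z"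
    using \<rho> by (simp add: powr_add mult.commute)
  then have "r / gauge \<gamma> z powr \<gamma> / gauge \<gamma> z * (norm (grushin_grad \<gamma> \<phi> z) * norm w)
      = norm (grushin_grad \<gamma> \<phi> z)"
    using \<rho> by (simp add: field_simps)
  moreover have "r / gauge \<gamma> z powr \<gamma> / gauge \<gamma> z * \<bar>L (euler_field \<gamma> z)\<bar>
      \<le> r / gauge \<gamma> z powr \<gamma> / gauge \<gamma> z * (norm (grushin_grad \<gamma> \<phi> z) * norm w)"
    using CS r \<rho> by (intro mult_left_mono) auto
  ultimately show ?thesis by (simp add: r_def L_def)
qed

section \<open>Smoothness and support of test functions\<close>

lemma smooth_on_UNIV_differentiable:
  assumes "smooth_on UNIV \<phi>"
  shows "\<phi> differentiable (at z)"
  using assms unfolding smooth_on_def by (metis UNIV_I dderiv.simps(1))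

text \<open>\<open>smooth_on\<close> speaks of derivatives in fixed directions only, so the varying
  direction \<open>X z\<close> is expanded in the basis.\<close>

lemma continuous_on_frechet_derivative_smooth:
  fixes \<phi> :: "'a::euclidean_space \<Rightarrow> real"
  assumes "smooth_on UNIV \<phi>" and X: "continuous_on UNIV X"
  shows "continuous_on UNIV (\<lambda>z. frechet_derivative \<phi> (at z) (X z))"
proof -
  have "continuous_on UNIV (\<lambda>z. frechet_derivative \<phi> (at z) b)" for b
  proof -
    have "dderiv [b] \<phi> differentiable (at z)" for z
      using assms unfolding smooth_on_def by blast
    then show ?thesis
      by (simp add: continuous_at_imp_continuous_on differentiable_imp_continuous_within)
  qed
  then have "continuous_on UNIV (\<lambda>z. \<Sum>b\<in>Basis. (X z \<bullet> b) * frechet_derivative \<phi> (at z) b)"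
    by (intro continuous_intros X)
  moreover have "frechet_derivative \<phi> (at z) (X z) = (\<Sum>b\<in>Basis. (X z \<bullet> b) * frechet_derivative \<phi> (at z) b)" for z
  proof -
    interpret bounded_linear "frechet_derivative \<phi> (at z)"
      using smooth_on_UNIV_differentiable[OF assms(1)] frechet_derivative_works
        has_derivative_bounded_linear by blast
    show ?thesis
      by (subst euclidean_representation[of "X z", symmetric]) (simp only: sum scale real_scaleR_def)
  qed
  ultimately show ?thesis by simp
qed

text \<open>\<open>\<phi>\<close> vanishes on a neighbourhood of such a point. This confines the
  gradient integral over the whole space to \<open>\<Omega>\<close>.\<close>

lemma grushin_grad_outside_support:
  assumes "z \<notin> closure {z. \<phi> z \<noteq> 0}"
  shows "grushin_grad \<gamma> \<phi> z = 0"
proof -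
  have "(\<phi> has_derivative (\<lambda>h. 0)) (at z)"
  proof (rule has_derivative_transform_within_open[OF has_derivative_const[of 0]])
    show "open (- closure {z. \<phi> z \<noteq> 0})" "z \<in> - closure {z. \<phi> z \<noteq> 0}"
      using assms by auto
    show "0 = \<phi> w" if "w \<in> - closure {z. \<phi> z \<noteq> 0}" for w
      using that closure_subset[of "{z. \<phi> z \<noteq> 0}"] by auto
  qed
  then have "frechet_derivative \<phi> (at z) = (\<lambda>h. 0)"
    by (rule frechet_derivative_at[symmetric])
  then show ?thesis by (simp add: grushin_grad_def prod_eq_iff)
qed

section \<open>From the Euler derivative to the Grushin gradient\<close>

lemma borel_measurable_gauge [measurable]:
  "gauge \<gamma> \<in> borel_measurable (borel :: ('a::euclidean_space \<times> 'b::euclidean_space) measure)"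
proof -
  have [measurable]: "fst \<in> borel_measurable (borel :: ('a \<times> 'b) measure)"
    "snd \<in> borel_measurable (borel :: ('a \<times> 'b) measure)"
    by (intro borel_measurable_continuous_onI continuous_intros)+
  show ?thesis unfolding gauge_def[abs_def] by measurable
qed

theorem theorem3p3:
  fixes \<Omega> :: "('a::euclidean_space \<times> 'b::euclidean_space) set"
    and \<gamma> \<alpha> t p :: real and \<phi> :: "'a \<times> 'b \<Rightarrow> real"
  assumes "\<gamma> > 0"
    and "\<Omega> = UNIV \<or> (open \<Omega> \<and> connected \<Omega> \<and> smooth_boundary \<Omega> \<and> (0::'a\<times>'b) \<in> \<Omega>)"
    and "1 \<le> p"
    and "hom_dim \<gamma> TYPE('a) TYPE('b) + \<alpha> - p > 0"
    and "\<phi> \<in> test_functions \<Omega>"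
  shows "(\<integral>\<^sup>+ z \<in> \<Omega>. ennreal (gauge \<gamma> z powr \<alpha> * norm (grushin_grad \<gamma> (gauge \<gamma>) z) powr t
              * norm (grushin_grad \<gamma> \<phi> z) powr p) \<partial>lborel)
         \<ge> ennreal (((hom_dim \<gamma> TYPE('a) TYPE('b) + \<alpha> - p) / p) powr p)
           * (\<integral>\<^sup>+ z \<in> \<Omega>. ennreal (gauge \<gamma> z powr \<alpha> * norm (grushin_grad \<gamma> (gauge \<gamma>) z) powr t
              * (norm (grushin_grad \<gamma> (gauge \<gamma>) z) powr p / gauge \<gamma> z powr p) * \<bar>\<phi> z\<bar> powr p) \<partial>lborel)"
proof -
  \<comment> \<open>Closed form of \<open>norm (grushin_grad \<gamma> (gauge \<gamma>) z)\<close>,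
    valid for \<open>fst z \<noteq> 0\<close>. With it \<open>V\<close> is measurable and
    homogeneous at every point, as \<open>hardy_dilation\<close> demands.\<close>
  define N where "N z = norm (fst z) powr \<gamma> / gauge \<gamma> z powr \<gamma>" for z :: "'a \<times> 'b"
  define V where "V z = gauge \<gamma> z powr \<alpha> * N z powr t * (N z powr p / gauge \<gamma> z powr p)" for z
  define E where "E z = frechet_derivative \<phi> (at z) (euler_field \<gamma> z)" for z
  have smooth: "smooth_on UNIV \<phi>" and supp: "closure {z. \<phi> z \<noteq> 0} \<subseteq> \<Omega>"
    and "compact (closure {z. \<phi> z \<noteq> 0})"
    using assms(5) by (auto simp: test_functions_def)
  then have "bounded {z. \<phi> z \<noteq> 0}"
    by (meson bounded_subset closure_subset compact_imp_bounded)
  have diff: "\<phi> differentiable (at z)" for z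
    using smooth by (rule smooth_on_UNIV_differentiable)
  have [measurable]: "fst \<in> borel_measurable (borel :: ('a \<times> 'b) measure)"
    by (intro borel_measurable_continuous_onI continuous_intros)
  have [measurable]: "N \<in> borel_measurable borel"
    unfolding N_def[abs_def] by measurable
  have V_hom: "V (dil \<gamma> s z) = exp ((\<alpha> - p) * s) * V z" for s z
  proof -
    have "N (dil \<gamma> s z) = N z"
      using assms(1) by (simp add: N_def gauge_dil powr_mult)
    then show ?thesis
      using assms(1)
      by (simp add: V_def gauge_dil powr_mult exp_powr_real left_diff_distrib exp_diff)
         (simp add: mult_ac)
  qed
  \<comment> \<open>On this side the domain may be enlarged to the whole space, as the integrand is
    nonnegative.\<close>
  have "(\<integral>\<^sup>+ z \<in> \<Omega>. ennreal (gauge \<gamma> z powr \<alpha> * norm (grushin_grad \<gamma> (gauge \<gamma>) z) powr t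
              * (norm (grushin_grad \<gamma> (gauge \<gamma>) z) powr p / gauge \<gamma> z powr p) * \<bar>\<phi> z\<bar> powr p) \<partial>lborel)
      \<le> (\<integral>\<^sup>+z. ennreal (V z * \<bar>\<phi> z\<bar> powr p) \<partial>lborel)"
    using AE_lborel_fst_neq_0
    by (intro nn_integral_mono_AE, eventually_elim)
       (auto simp: V_def N_def norm_grushin_grad_gauge[OF assms(1)] split: split_indicator)
  then have "ennreal (((hom_dim \<gamma> TYPE('a) TYPE('b) + \<alpha> - p) / p) powr p)
      * (\<integral>\<^sup>+ z \<in> \<Omega>. ennreal (gauge \<gamma> z powr \<alpha> * norm (grushin_grad \<gamma> (gauge \<gamma>) z) powr t
              * (norm (grushin_grad \<gamma> (gauge \<gamma>) z) powr p / gauge \<gamma> z powr p) * \<bar>\<phi> z\<bar> powr p) \<partial>lborel)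
      \<le> ennreal (((hom_dim \<gamma> TYPE('a) TYPE('b) + (\<alpha> - p)) / p) powr p)
      * (\<integral>\<^sup>+z. ennreal (V z * \<bar>\<phi> z\<bar> powr p) \<partial>lborel)"
    by (simp add: add_diff_eq mult_left_mono)
  also have "\<dots> \<le> (\<integral>\<^sup>+z. ennreal (V z * \<bar>E z\<bar> powr p) \<partial>lborel)"
    unfolding E_def
  proof (rule hardy_dilation)
    show "continuous_on UNIV (\<lambda>z. frechet_derivative \<phi> (at z) (euler_field \<gamma> z))"
      unfolding euler_field_def
      by (intro continuous_on_frechet_derivative_smooth smooth continuous_intros)
    show "V \<in> borel_measurable borel" unfolding V_def[abs_def] by measurable
    show "V z \<ge> 0" for z by (simp add: V_def)
  qed (use diff V_hom assms \<open>bounded {z. \<phi> z \<noteq> 0}\<close> in auto)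
  also have "\<dots> \<le> (\<integral>\<^sup>+ z \<in> \<Omega>. ennreal (gauge \<gamma> z powr \<alpha> * norm (grushin_grad \<gamma> (gauge \<gamma>) z) powr t
              * norm (grushin_grad \<gamma> \<phi> z) powr p) \<partial>lborel)"
  proof (rule nn_integral_mono_AE, use AE_lborel_fst_neq_0 in eventually_elim)
    fix z :: "'a \<times> 'b" assume z: "fst z \<noteq> 0"
    have \<rho>: "gauge \<gamma> z > 0" using z by (rule gauge_pos)
    have "(N z / gauge \<gamma> z * \<bar>E z\<bar>) powr p \<le> norm (grushin_grad \<gamma> \<phi> z) powr p"
      unfolding N_def E_def using assms \<rho>
      by (intro powr_mono2 euler_derivative_le_grushin_grad z diff) auto
    then have "N z powr p / gauge \<gamma> z powr p * \<bar>E z\<bar> powr p \<le> norm (grushin_grad \<gamma> \<phi> z) powr p"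
      using \<rho> by (simp add: powr_mult powr_divide N_def)
    then have "gauge \<gamma> z powr \<alpha> * N z powr t * (N z powr p / gauge \<gamma> z powr p * \<bar>E z\<bar> powr p)
        \<le> gauge \<gamma> z powr \<alpha> * N z powr t * norm (grushin_grad \<gamma> \<phi> z) powr p"
      by (intro mult_left_mono) auto
    then have le: "V z * \<bar>E z\<bar> powr p \<le> gauge \<gamma> z powr \<alpha> * norm (grushin_grad \<gamma> (gauge \<gamma>) z) powr t
        * norm (grushin_grad \<gamma> \<phi> z) powr p"
      using norm_grushin_grad_gauge[OF assms(1) z] by (simp add: V_def N_def mult.assoc)
    show "ennreal (V z * \<bar>E z\<bar> powr p) \<le> ennreal (gauge \<gamma> z powr \<alpha>
        * norm (grushin_grad \<gamma> (gauge \<gamma>) z) powr t * norm (grushin_grad \<gamma> \<phi> z) powr p) * indicator \<Omega> z"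
    proof (cases "z \<in> \<Omega>")
      \<comment> \<open>The right-hand side is 0 here because \<open>0 powr p = 0\<close>, and
        \<open>le\<close> then makes the left-hand side vanish as well.\<close>
      case False
      then have "grushin_grad \<gamma> \<phi> z = 0"
        using supp by (intro grushin_grad_outside_support) auto
      then show ?thesis using le by (simp add: ennreal_neg)
    qed (use le in \<open>simp add: ennreal_leI\<close>)
  qed
  finally show ?thesis .
qed

end
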